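(* For every complex sequence $\alpha\in h^{1/2}$ the inequality $$H(\alpha)\le Q(\alpha)^2$$ holds. Moreover, $H(\alpha)=Q(\alpha)^2$ if and only if there exist $c,p\in\mathbb{C}$ with $|p|<1$ such that $\alpha_n=c\,p^n$ for all $n\in\mathbb{N}$.
   Context: $\mathbb{N}=\{0,1,2,\dots\}$, and $0^0=1$. $h^{1/2}$ is the space of complex sequences $\alpha=(\alpha_n)_{n\in\mathbb{N}}$ with $\sum_{n\ge0}(n+1)|\alpha_n|^2<\infty$. The functionals are $$H(\alpha)=\sum_{n=0}^{\infty}\sum_{j=0}^{\infty}\sum_{k=0}^{n+j}\left[\min(n,j,k,n+j-k)+1\right]\bar\alpha_n\bar\alpha_j\alpha_k\alpha_{n+j-k},\qquad Q(\alpha)=\sum_{n=0}^\infty(n+1)|\alpha_n|^2.$$ *)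

theory Defs
  imports Complex_Main
begin

definition h_half :: "(nat \<Rightarrow> complex) set" where
  "h_half = {\<alpha>. summable (\<lambda>n. real (n + 1) * (cmod (\<alpha> n))\<^sup>2)}"

definition Q :: "(nat \<Rightarrow> complex) \<Rightarrow> real" where
  "Q \<alpha> = (\<Sum>n. real (n + 1) * (cmod (\<alpha> n))\<^sup>2)"

definition H_term :: "(nat \<Rightarrow> complex) \<Rightarrow> nat \<Rightarrow> nat \<Rightarrow> complex" where
  "H_term \<alpha> n j =
     (\<Sum>k=0..n + j. of_nat (min (min n j) (min k (n + j - k)) + 1)
        * cnj (\<alpha> n) * cnj (\<alpha> j) * \<alpha> k * \<alpha> (n + j - k))"

text \<open>The value is a priori complex, and it is meaningful only if the inner series converge for
  every \<open>n\<close> and the outer series converges.\<close>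

definition H :: "(nat \<Rightarrow> complex) \<Rightarrow> complex" where
  "H \<alpha> = (\<Sum>n. \<Sum>j. H_term \<alpha> n j)"

definition H_converges :: "(nat \<Rightarrow> complex) \<Rightarrow> bool" where
  "H_converges \<alpha> \<longleftrightarrow>
     (\<forall>n. summable (\<lambda>j. H_term \<alpha> n j)) \<and> summable (\<lambda>n. \<Sum>j. H_term \<alpha> n j)"

end

theory Submission
  imports Defs "HOL-Analysis.Infinite_Sum" "HOL-Analysis.Elementary_Metric_Spaces"
begin

text \<open>
  On the antidiagonal \<open>n + j = m\<close> put \<open>b\<^sub>n = \<alpha>\<^sub>n \<alpha>\<^bsub>m-n\<^esub>\<close>. The weight \<open>min n j k (m - k) + 1\<close> counts the \<open>i\<close>
  for which both \<open>n\<close> and \<open>k\<close> lie in \<open>{i..m-i}\<close>, so the antidiagonal part of \<open>H\<close> is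
  \<open>\<Sum>i. \<bar>\<Sum>n\<in>{i..m-i}. b\<^sub>n\<bar>\<^sup>2\<close>. The Cauchy-Schwarz inequality on each interval and
  \<open>(\<Sum>i\<le>min n (m-n). m + 1 - 2i) = (n + 1) (m - n + 1)\<close> bound it by
  \<open>\<Sum>n\<le>m. (n + 1) (m - n + 1) \<bar>b\<^sub>n\<bar>\<^sup>2\<close>, which is the antidiagonal part of \<open>Q\<^sup>2\<close>. Equality forces
  \<open>b\<close> to be constant on \<open>{0..m}\<close> for every \<open>m\<close>, i.e. \<open>\<alpha>\<close> to be geometric. The same bound for
  \<open>\<bar>\<alpha>\<bar>\<close> gives absolute convergence, which justifies summing along antidiagonals.
\<close>

section \<open>Double series over \<open>nat \<times> nat\<close> and their antidiagonals\<close>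

lemma has_sum_antidiagonal_iff:
  fixes f :: "nat \<times> nat \<Rightarrow> 'a :: {comm_monoid_add, topological_space}"
  shows "((\<lambda>(m, n). f (n, m - n)) has_sum s) (SIGMA m:UNIV. {..m}) \<longleftrightarrow> (f has_sum s) UNIV"
  by (rule has_sum_reindex_bij_witness[where j = "\<lambda>(m, n). (n, m - n)" and i = "\<lambda>(n, j). (n + j, n)"])
     auto

lemma has_sum_antidiagonal:
  fixes f :: "nat \<times> nat \<Rightarrow> 'a :: {topological_comm_monoid_add, t3_space}"
  assumes "(f has_sum s) UNIV"
  shows "((\<lambda>m. \<Sum>n\<le>m. f (n, m - n)) has_sum s) UNIV"
proof (rule has_sum_SigmaD)
  show "((\<lambda>(m, n). f (n, m - n)) has_sum s) (SIGMA m:UNIV. {..m})"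
    using assms by (simp add: has_sum_antidiagonal_iff)
qed (simp add: has_sum_finite)

text \<open>Nonnegative terms cannot cancel within an antidiagonal, so the finite block sums control
  the whole family (Tonelli).\<close>

lemma summable_on_antidiagonal:
  fixes f :: "nat \<times> nat \<Rightarrow> real"
  assumes "(\<lambda>m. \<Sum>n\<le>m. f (n, m - n)) summable_on UNIV" and "\<And>x. f x \<ge> 0"
  shows "f summable_on UNIV"
proof -
  have "(\<lambda>(m, n). f (n, m - n)) summable_on (SIGMA m:UNIV. {..m})"
    by (rule summable_on_SigmaI[OF _ assms(1)]) (auto simp: has_sum_finite assms(2))
  then show ?thesis
    unfolding summable_on_def by (simp add: has_sum_antidiagonal_iff)
qed

lemma has_sum_times_nonneg:
  fixes f g :: "nat \<Rightarrow> real"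
  assumes "(f has_sum a) UNIV" "(g has_sum b) UNIV" "\<And>n. f n \<ge> 0" "\<And>n. g n \<ge> 0"
  shows "((\<lambda>(n, j). f n * g j) has_sum a * b) UNIV"
proof -
  have inner: "((\<lambda>j. case (n, j) of (n, j) \<Rightarrow> f n * g j) has_sum f n * b) UNIV" for n
    using has_sum_cmult_right[OF assms(2)] by simp
  have outer: "((\<lambda>n. f n * b) has_sum a * b) UNIV"
    using has_sum_cmult_left[OF assms(1)] .
  have "((\<lambda>(n, j). f n * g j) has_sum a * b) (SIGMA n:UNIV. UNIV)"
  proof (rule has_sum_SigmaI)
    show "(\<lambda>(n, j). f n * g j) summable_on (SIGMA n:UNIV. UNIV)"
      by (rule summable_on_SigmaI[where g = "\<lambda>n. f n * b"])
         (use inner outer assms in \<open>auto simp: summable_on_def\<close>)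
  qed (use inner outer in auto)
  then show ?thesis by simp
qed

section \<open>The Cauchy-Schwarz inequality and its equality case\<close>

text \<open>Lagrange's identity for \<open>b\<close> against the constant 1. The left side is a sum
  of squares: its sign gives the inequality, its vanishing the equality case.\<close>

lemma sum_cmod_diff_square:
  fixes b :: "'a \<Rightarrow> complex"
  shows "(\<Sum>n\<in>A. \<Sum>k\<in>A. (cmod (b n - b k))\<^sup>2)
    = 2 * (real (card A) * (\<Sum>n\<in>A. (cmod (b n))\<^sup>2) - (cmod (\<Sum>n\<in>A. b n))\<^sup>2)"
proof -
  have pt: "(cmod (x - y))\<^sup>2 = (cmod x)\<^sup>2 + (cmod y)\<^sup>2 - 2 * Re (x * cnj y)" for x y
    by (simp only: cmod_power2 minus_complex.simps times_complex.simps cnj.simps)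
       (simp add: power2_eq_square algebra_simps)
  have "(\<Sum>n\<in>A. \<Sum>k\<in>A. Re (b n * cnj (b k))) = Re ((\<Sum>n\<in>A. b n) * cnj (\<Sum>n\<in>A. b n))"
    by (simp add: sum_product)
  also have "\<dots> = (cmod (\<Sum>n\<in>A. b n))\<^sup>2"
    by (metis Re_complex_of_real complex_norm_square)
  finally have cross: "(\<Sum>n\<in>A. \<Sum>k\<in>A. Re (b n * cnj (b k))) = (cmod (\<Sum>n\<in>A. b n))\<^sup>2" .
  have "(\<Sum>n\<in>A. \<Sum>k\<in>A. (cmod (b n - b k))\<^sup>2) = 
      2 * real (card A) * (\<Sum>n\<in>A. (cmod (b n))\<^sup>2) - 2 * (\<Sum>n\<in>A. \<Sum>k\<in>A. Re (b n * cnj (b k)))"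
    unfolding pt by (simp only: sum.distrib sum_subtractf sum_distrib_left[symmetric] sum_constant)
  then show ?thesis unfolding cross by (simp add: algebra_simps)
qed

lemma cmod_sum_square_le:
  fixes b :: "'a \<Rightarrow> complex"
  shows "(cmod (\<Sum>n\<in>A. b n))\<^sup>2 \<le> real (card A) * (\<Sum>n\<in>A. (cmod (b n))\<^sup>2)"
proof -
  have "0 \<le> (\<Sum>n\<in>A. \<Sum>k\<in>A. (cmod (b n - b k))\<^sup>2)" by (intro sum_nonneg) auto
  then show ?thesis by (simp add: sum_cmod_diff_square)
qed

lemma cmod_sum_square_eqD:
  fixes b :: "'a \<Rightarrow> complex"
  assumes "finite A" "(cmod (\<Sum>n\<in>A. b n))\<^sup>2 = real (card A) * (\<Sum>n\<in>A. (cmod (b n))\<^sup>2)"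
    and "n \<in> A" "k \<in> A"
  shows "b n = b k"
proof -
  have "(\<Sum>n\<in>A. \<Sum>k\<in>A. (cmod (b n - b k))\<^sup>2) = 0" using assms(2) by (simp add: sum_cmod_diff_square)
  then have "(\<Sum>k\<in>A. (cmod (b n - b k))\<^sup>2) = 0"
    using assms(1,3) by (subst (asm) sum_nonneg_eq_0_iff) (auto intro: sum_nonneg)
  then have "(cmod (b n - b k))\<^sup>2 = 0"
    using assms(1,4) by (subst (asm) sum_nonneg_eq_0_iff) auto
  then show ?thesis by simp
qed

section \<open>The weights of \<open>H\<close> and \<open>Q\<close> as counts over nested
  intervals\<close>

lemma sum_min_weight:
  fixes b :: "nat \<Rightarrow> complex"
  shows "(\<Sum>n\<le>m. \<Sum>k\<le>m. of_nat (min (min n (m - n)) (min k (m - k)) + 1) * cnj (b n) * b k)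
    = of_real (\<Sum>i\<le>m. (cmod (\<Sum>n\<in>{i..m - i}. b n))\<^sup>2)"
proof -
  let ?I = "\<lambda>i n. of_bool (n \<in> {i..m - i}) :: complex"
  have weight: "of_nat (min (min n (m - n)) (min k (m - k)) + 1) = (\<Sum>i\<le>m. ?I i n * ?I i k)"
    if "n \<le> m" "k \<le> m" for n k
  proof -
    \<comment> \<open>Both \<open>n\<close> and \<open>k\<close> lie in \<open>{i..m - i}\<close>
      exactly when \<open>i\<close> is at most each of \<open>n\<close>, \<open>m - n\<close>,
      \<open>k\<close>, \<open>m - k\<close>.\<close>
    have "(\<Sum>i\<le>m. ?I i n * ?I i k) = (\<Sum>i\<le>m. of_bool (i \<in> {..min (min n (m - n)) (min k (m - k))}))"
      using that by (intro sum.cong) (auto simp: of_bool_conj[symmetric])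
    \<comment> \<open>The minimum is at most \<open>m\<close>, so no \<open>i\<close> is lost;
      counting from \<open>i = 0\<close> produces the \<open>+ 1\<close>.\<close>
    also have "\<dots> = (\<Sum>i\<in>{..min (min n (m - n)) (min k (m - k))}. 1)"
      using that by (intro sum.mono_neutral_cong_right) auto
    finally show ?thesis by simp
  qed
  have cnj_I: "cnj (?I i n) = ?I i n" for i n
    by (cases "n \<in> {i..m - i}") auto
  have I: "(\<Sum>n\<in>{i..m - i}. b n) = (\<Sum>n\<le>m. ?I i n * b n)" for i
    by (intro sum.mono_neutral_cong_left) auto
  have "(\<Sum>n\<le>m. \<Sum>k\<le>m. of_nat (min (min n (m - n)) (min k (m - k)) + 1) * cnj (b n) * b k)
      = (\<Sum>n\<le>m. \<Sum>k\<le>m. \<Sum>i\<le>m. cnj (?I i n * b n) * (?I i k * b k))"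
    by (intro sum.cong refl, subst weight)
       (simp_all only: atMost_iff sum_distrib_left sum_distrib_right complex_cnj_mult cnj_I mult_ac)
  also have "\<dots> = (\<Sum>n\<le>m. \<Sum>i\<le>m. \<Sum>k\<le>m. cnj (?I i n * b n) * (?I i k * b k))"
    by (rule sum.cong[OF refl], rule sum.swap)
  also have "\<dots> = (\<Sum>i\<le>m. \<Sum>n\<le>m. \<Sum>k\<le>m. cnj (?I i n * b n) * (?I i k * b k))"
    by (rule sum.swap)
  also have "\<dots> = (\<Sum>i\<le>m. cnj (\<Sum>n\<le>m. ?I i n * b n) * (\<Sum>n\<le>m. ?I i n * b n))"
    by (simp only: sum_product cnj_sum)
  also have "\<dots> = of_real (\<Sum>i\<le>m. (cmod (\<Sum>n\<in>{i..m - i}. b n))\<^sup>2)"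
    unfolding of_real_sum I by (intro sum.cong refl) (simp only: complex_norm_square mult.commute)
  finally show ?thesis .
qed

lemma sum_card_intervals:
  fixes f :: "nat \<Rightarrow> real"
  shows "(\<Sum>i\<le>m. real (card {i..m - i}) * (\<Sum>n\<in>{i..m - i}. f n))
    = (\<Sum>n\<le>m. real (n + 1) * real (m - n + 1) * f n)"
proof -
  have arith: "(\<Sum>i\<le>\<mu>. real m + 1 - 2 * real i) = (real \<mu> + 1) * (real m + 1 - real \<mu>)" for \<mu> :: nat
    by (induction \<mu>) (auto simp: algebra_simps)
  have weight: "(\<Sum>i\<le>m. of_bool (n \<in> {i..m - i}) * real (card {i..m - i})) = real (n + 1) * real (m - n + 1)"
    if "n \<le> m" for n
  proof -
    \<comment> \<open>For \<open>i \<le> min n (m - n)\<close> one has \<open>2 * i \<le> m\<close>,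
      so the cardinality is \<open>m + 1 - 2 * i\<close> without truncation.\<close>
    have "(\<Sum>i\<le>m. of_bool (n \<in> {i..m - i}) * real (card {i..m - i}))
        = (\<Sum>i\<le>min n (m - n). real m + 1 - 2 * real i)"
      using that by (intro sum.mono_neutral_cong_right) auto
    also have "\<dots> = real (n + 1) * real (m - n + 1)"
      \<comment> \<open>The product \<open>(\<mu> + 1) * (m + 1 - \<mu>)\<close> takes the same
        value at \<open>\<mu> = n\<close> and \<open>\<mu> = m - n\<close>, so either value of the
        minimum will do.\<close>
      unfolding arith using that by (auto simp: min_def algebra_simps)
    finally show ?thesis .
  qed
  have "(\<Sum>i\<le>m. real (card {i..m - i}) * (\<Sum>n\<in>{i..m - i}. f n))
      = (\<Sum>i\<le>m. \<Sum>n\<le>m. of_bool (n \<in> {i..m - i}) * real (card {i..m - i}) * f n)"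
    unfolding sum_distrib_left by (intro sum.cong[OF refl] sum.mono_neutral_cong_left) auto
  also have "\<dots> = (\<Sum>n\<le>m. \<Sum>i\<le>m. of_bool (n \<in> {i..m - i}) * real (card {i..m - i}) * f n)"
    by (rule sum.swap)
  also have "\<dots> = (\<Sum>n\<le>m. real (n + 1) * real (m - n + 1) * f n)"
    unfolding sum_distrib_right[symmetric] by (intro sum.cong refl, subst weight) auto
  finally show ?thesis .
qed

section \<open>Antidiagonal parts of \<open>H\<close> and of the square of \<open>Q\<close>\<close>

definition H_diag :: "(nat \<Rightarrow> complex) \<Rightarrow> nat \<Rightarrow> real" where
  "H_diag \<alpha> m = (\<Sum>i\<le>m. (cmod (\<Sum>n\<in>{i..m - i}. \<alpha> n * \<alpha> (m - n)))\<^sup>2)"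

text \<open>Kept as products of two summands of \<open>Q\<close>, the form in which the Cauchy
  product of that series with itself delivers it.\<close>

definition Q_diag :: "(nat \<Rightarrow> complex) \<Rightarrow> nat \<Rightarrow> real" where
  "Q_diag \<alpha> m = (\<Sum>n\<le>m. (real (n + 1) * (cmod (\<alpha> n))\<^sup>2) * (real (m - n + 1) * (cmod (\<alpha> (m - n)))\<^sup>2))"

lemma sum_H_term_antidiagonal: "(\<Sum>n\<le>m. H_term \<alpha> n (m - n)) = of_real (H_diag \<alpha> m)"
  unfolding H_diag_def sum_min_weight[symmetric]
  by (intro sum.cong refl) (auto simp: H_term_def atMost_atLeast0 mult_ac intro!: sum.cong)

lemma Q_diag_eq:
  "Q_diag \<alpha> m = (\<Sum>i\<le>m. real (card {i..m - i}) * (\<Sum>n\<in>{i..m - i}. (cmod (\<alpha> n * \<alpha> (m - n)))\<^sup>2))"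
  unfolding sum_card_intervals Q_diag_def
  by (intro sum.cong refl) (simp only: norm_mult power_mult_distrib mult_ac)

lemma H_diag_le_Q_diag: "H_diag \<alpha> m \<le> Q_diag \<alpha> m"
  unfolding H_diag_def Q_diag_eq by (intro sum_mono cmod_sum_square_le)

lemma H_diag_eq_Q_diagD:
  assumes "H_diag \<alpha> m = Q_diag \<alpha> m" "n \<le> m" "k \<le> m"
  shows "\<alpha> n * \<alpha> (m - n) = \<alpha> k * \<alpha> (m - k)"
proof -
  \<comment> \<open>Equal totals force equality in every Cauchy-Schwarz estimate; the one for
    \<open>i = 0\<close> covers the whole antidiagonal.\<close>
  have "(cmod (\<Sum>n\<in>{0..m - 0}. \<alpha> n * \<alpha> (m - n)))\<^sup>2
      = real (card {0..m - 0}) * (\<Sum>n\<in>{0..m - 0}. (cmod (\<alpha> n * \<alpha> (m - n)))\<^sup>2)"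
    using assms(1) unfolding H_diag_def Q_diag_eq
    by (rule sum_mono_inv) (auto intro: cmod_sum_square_le simp del: card_atLeastAtMost)
  then show ?thesis
    using assms by (intro cmod_sum_square_eqD[where A = "{0..m - 0}" and b = "\<lambda>n. \<alpha> n * \<alpha> (m - n)"]) auto
qed

section \<open>Geometric sequences\<close>

lemma H_diag_geometric:
  assumes "\<And>n. \<alpha> n = c * p ^ n"
  shows "H_diag \<alpha> m = Q_diag \<alpha> m"
proof -
  have const: "\<alpha> n * \<alpha> (m - n) = c\<^sup>2 * p ^ m" if "n \<in> {i..m - i}" for n i
  proof -
    have "n + (m - n) = m" using that by auto
    then show ?thesis by (simp add: assms power2_eq_square mult_ac flip: power_add)
  qed
  have "(\<Sum>n\<in>{i..m - i}. \<alpha> n * \<alpha> (m - n)) = of_nat (card {i..m - i}) * (c\<^sup>2 * p ^ m)"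
    "(\<Sum>n\<in>{i..m - i}. (cmod (\<alpha> n * \<alpha> (m - n)))\<^sup>2) = real (card {i..m - i}) * (cmod (c\<^sup>2 * p ^ m))\<^sup>2" for i
    using const[of _ i] by (simp_all del: card_atLeastAtMost atLeastAtMost_iff cong: sum.cong)
  then show ?thesis
    unfolding H_diag_def Q_diag_eq
    by (intro sum.cong refl) (simp only: norm_mult norm_of_nat power_mult_distrib power2_eq_square mult_ac)
qed

lemma geometricI:
  fixes \<alpha> :: "nat \<Rightarrow> 'a :: field"
  assumes "\<And>m n k. n \<le> m \<Longrightarrow> k \<le> m \<Longrightarrow> \<alpha> n * \<alpha> (m - n) = \<alpha> k * \<alpha> (m - k)"
  shows "\<exists>c p. \<forall>n. \<alpha> n = c * p ^ n"
proof (cases "\<alpha> 0 = 0")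
  case True
  have "\<alpha> n = 0" for n
    \<comment> \<open>The antidiagonal \<open>2 * n\<close> compares the square of
      \<open>\<alpha> n\<close> with \<open>\<alpha> 0 * \<alpha> (2 * n) = 0\<close>.\<close>
    using assms[of n "n + n" 0] True by simp
  then have "\<forall>n. \<alpha> n = 0 * 0 ^ n" by simp
  then show ?thesis by blast
next
  case False
  have "\<alpha> n = \<alpha> 0 * (\<alpha> 1 / \<alpha> 0) ^ n" for n
  proof (induction n)
    case (Suc n)
    \<comment> \<open>Comparing positions 0 and 1 gives a first-order recursion with ratio
      \<open>\<alpha> 1 / \<alpha> 0\<close>.\<close>
    have "\<alpha> 0 * \<alpha> (Suc n) = \<alpha> 1 * \<alpha> n" using assms[of 0 "Suc n" 1] by simp
    then show ?case using False by (subst (asm) Suc) (simp add: field_simps)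
  qed simp
  then show ?thesis by blast
qed

text \<open>Otherwise the terms of the convergent series \<open>Q\<close> would stay above the
  positive square of \<open>cmod c\<close> and could not tend to 0.\<close>

lemma geometric_in_h_halfD:
  assumes "\<alpha> \<in> h_half" "c \<noteq> 0" "\<And>n. \<alpha> n = c * p ^ n"
  shows "cmod p < 1"
proof (rule ccontr)
  assume "\<not> cmod p < 1"
  then have "(cmod c)\<^sup>2 \<le> real (n + 1) * (cmod (\<alpha> n))\<^sup>2" for n
  proof -
    have "1 * ((cmod c)\<^sup>2 * 1) \<le> real (n + 1) * ((cmod c)\<^sup>2 * (cmod p ^ n)\<^sup>2)"
      using \<open>\<not> cmod p < 1\<close> by (intro mult_mono mult_left_mono one_le_power) auto
    then show ?thesis by (simp add: assms norm_mult norm_power power_mult_distrib)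
  qed
  moreover have "(\<lambda>n. real (n + 1) * (cmod (\<alpha> n))\<^sup>2) \<longlonglongrightarrow> 0"
    using assms(1) unfolding h_half_def by (auto intro: summable_LIMSEQ_zero)
  ultimately have "(cmod c)\<^sup>2 \<le> 0"
    by (intro LIMSEQ_le_const) auto
  then show False using assms(2) by simp
qed

section \<open>Convergence of the antidiagonal series and absolute convergence of
  \<open>H\<close>\<close>

lemma has_sum_Q_diag:
  assumes "\<alpha> \<in> h_half"
  shows "(Q_diag \<alpha> has_sum (Q \<alpha>)\<^sup>2) UNIV"
proof -
  have "((\<lambda>n. real (n + 1) * (cmod (\<alpha> n))\<^sup>2) has_sum Q \<alpha>) UNIV"
    using assms unfolding h_half_def Q_def by (intro sums_nonneg_imp_has_sum) auto
  from has_sum_antidiagonal[OF has_sum_times_nonneg[OF this this]]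
  show ?thesis by (simp add: Q_diag_def[abs_def] power2_eq_square)
qed

text \<open>Triangle inequality with nonnegative weights. The bound is again an
  \<open>H_term\<close>, so the antidiagonal estimate applies to the sequence of moduli.\<close>

lemma norm_H_term_le: "norm (H_term \<alpha> n j) \<le> Re (H_term (\<lambda>i. of_real (cmod (\<alpha> i))) n j)"
  unfolding H_term_def
  by (rule order_trans[OF norm_sum]) (simp add: norm_mult del: of_nat_add of_nat_Suc)

lemma abs_summable_H_term:
  assumes "\<alpha> \<in> h_half"
  shows "(\<lambda>(n, j). H_term \<alpha> n j) abs_summable_on UNIV"
proof (rule summable_on_antidiagonal)
  let ?a = "\<lambda>i. complex_of_real (cmod (\<alpha> i))"
  show "(\<lambda>m. \<Sum>n\<le>m. norm (case (n, m - n) of (n, j) \<Rightarrow> H_term \<alpha> n j)) summable_on UNIV"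
  proof (rule summable_on_comparison_test)
    show "Q_diag \<alpha> summable_on UNIV" using has_sum_Q_diag[OF assms] by (auto simp: summable_on_def)
    show "(\<Sum>n\<le>m. norm (case (n, m - n) of (n, j) \<Rightarrow> H_term \<alpha> n j)) \<le> Q_diag \<alpha> m" for m
    proof -
      have "(\<Sum>n\<le>m. norm (H_term \<alpha> n (m - n))) \<le> (\<Sum>n\<le>m. Re (H_term ?a n (m - n)))"
        by (intro sum_mono norm_H_term_le)
      also have "\<dots> = H_diag ?a m"
        by (simp add: sum_H_term_antidiagonal flip: Re_sum)
      also have "\<dots> \<le> Q_diag ?a m" by (rule H_diag_le_Q_diag)
      \<comment> \<open>\<open>Q_diag\<close> depends only on the moduli.\<close>
      also have "\<dots> = Q_diag \<alpha> m" by (simp add: Q_diag_def)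
      finally show ?thesis by simp
    qed
  qed (auto intro: sum_nonneg)
qed auto

theorem theorem2:
  fixes \<alpha> :: "nat \<Rightarrow> complex"
  assumes "\<alpha> \<in> h_half"
  shows "H_converges \<alpha> \<and> H \<alpha> \<in> \<real> \<and> Re (H \<alpha>) \<le> (Q \<alpha>)\<^sup>2
    \<and> (H \<alpha> = complex_of_real ((Q \<alpha>)\<^sup>2) \<longleftrightarrow>
         (\<exists>c p :: complex. cmod p < 1 \<and> (\<forall>n. \<alpha> n = c * p ^ n)))"
proof -
  have "(\<lambda>(n, j). H_term \<alpha> n j) summable_on UNIV"
    using abs_summable_H_term[OF assms] by (rule abs_summable_summable)
  then obtain s where s: "((\<lambda>(n, j). H_term \<alpha> n j) has_sum s) UNIV"
    by (auto simp: summable_on_def)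
  have inner: "H_term \<alpha> n summable_on UNIV" for n
    by (rule summable_on_SigmaD1[where A = UNIV and B = "\<lambda>_. UNIV"])
       (use s in \<open>auto simp: summable_on_def\<close>)
  then have inner_sums: "(H_term \<alpha> n has_sum (\<Sum>j. H_term \<alpha> n j)) UNIV" for n
    by (metis has_sum_imp_sums has_sum_infsum sums_unique)
  \<comment> \<open>Fubini: the iterated sum defining \<open>H\<close> equals the unordered sum
    \<open>s\<close>, which may then be regrouped.\<close>
  have "((\<lambda>n. \<Sum>j. H_term \<alpha> n j) has_sum s) UNIV"
    by (rule has_sum_SigmaD[where B = "\<lambda>_. UNIV"]) (use s inner_sums in auto)
  then have outer: "(\<lambda>n. \<Sum>j. H_term \<alpha> n j) sums s"
    by (rule has_sum_imp_sums)
  have conv: "H_converges \<alpha>"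
    using inner outer by (auto simp: H_converges_def sums_iff intro: summable_on_imp_summable)
  have H: "H \<alpha> = s" using outer by (simp add: H_def sums_iff)
  have diag: "((\<lambda>m. complex_of_real (H_diag \<alpha> m)) has_sum H \<alpha>) UNIV"
    using has_sum_antidiagonal[OF s] by (simp add: sum_H_term_antidiagonal H)
  then have ReH: "(H_diag \<alpha> has_sum Re (H \<alpha>)) UNIV"
    using has_sum_Re by fastforce
  then have "H \<alpha> = of_real (Re (H \<alpha>))"
    using diag has_sum_of_real has_sum_unique by blast
  then have real: "H \<alpha> \<in> \<real>" and eq_iff: "H \<alpha> = of_real ((Q \<alpha>)\<^sup>2) \<longleftrightarrow> Re (H \<alpha>) = (Q \<alpha>)\<^sup>2"
    by (metis Reals_of_real, metis Re_complex_of_real)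
  note Q = has_sum_Q_diag[OF assms]
  have le: "Re (H \<alpha>) \<le> (Q \<alpha>)\<^sup>2"
    using ReH Q by (rule has_sum_mono) (rule H_diag_le_Q_diag)
  have "Re (H \<alpha>) = (Q \<alpha>)\<^sup>2 \<longleftrightarrow> (\<exists>c p :: complex. cmod p < 1 \<and> (\<forall>n. \<alpha> n = c * p ^ n))"
  proof
    assume eq: "Re (H \<alpha>) = (Q \<alpha>)\<^sup>2"
    \<comment> \<open>All terms compare in one direction, so a single strict inequality would
      separate the two sums.\<close>
    have "H_diag \<alpha> m = Q_diag \<alpha> m" for m
    proof (rule ccontr)
      assume "H_diag \<alpha> m \<noteq> Q_diag \<alpha> m"
      then have "H_diag \<alpha> m < Q_diag \<alpha> m" using H_diag_le_Q_diag[of \<alpha> m] by simp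
      then have "Re (H \<alpha>) < (Q \<alpha>)\<^sup>2"
        by (intro has_sum_strict_mono[OF ReH Q, of m]) (auto intro: H_diag_le_Q_diag)
      with eq show False by simp
    qed
    then have const: "\<alpha> n * \<alpha> (m - n) = \<alpha> k * \<alpha> (m - k)" if "n \<le> m" "k \<le> m" for m n k
      using H_diag_eq_Q_diagD that by blast
    obtain c p where cp: "\<And>n. \<alpha> n = c * p ^ n" using geometricI[OF const] by blast
    show "\<exists>c p :: complex. cmod p < 1 \<and> (\<forall>n. \<alpha> n = c * p ^ n)"
    proof (cases "c = 0")
      case True
      \<comment> \<open>For the zero sequence the obtained \<open>p\<close> may have any modulus, so
        it is replaced by 0.\<close>
      with cp have "cmod 0 < 1 \<and> (\<forall>n. \<alpha> n = 0 * 0 ^ n)" by simp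
      then show ?thesis by blast
    next
      case False
      with cp geometric_in_h_halfD[OF assms] show ?thesis by blast
    qed
  next
    assume "\<exists>c p :: complex. cmod p < 1 \<and> (\<forall>n. \<alpha> n = c * p ^ n)"
    then have "H_diag \<alpha> = Q_diag \<alpha>" using H_diag_geometric by blast
    then show "Re (H \<alpha>) = (Q \<alpha>)\<^sup>2" using ReH Q has_sum_unique by metis
  qed
  with conv real le eq_iff show ?thesis by blast
qed

end
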